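(* Let $H_1, H_2$ be two complex separable Hilbert spaces and let $T : H_1 \to H_2$ be a bounded linear operator. Then for each $n \in \mathbb{N}$, $$\epsilon_n(T)=\epsilon_n(T^* )=\epsilon_n(|T|),$$ where $T^* : H_2 \to H_1$ denotes the Hilbert adjoint of $T$ and $|T| : H_1 \to H_1$ is the unique positive square root of $T^*T$.
   Context: For normed linear spaces $X, Y$ and a bounded linear operator $S : X \to Y$, let $U_X = \{x \in X : \|x\| \le 1\}$ be the closed unit ball of $X$ and, for $y_0 \in Y$ and $r>0$, let $U(y_0,r) = \{y \in Y : \|y-y_0\| \le r\}$. For $n \in \mathbb{N} = \{1,2,\dots\}$, the $n$-th entropy number of $S$ is $$\epsilon_n(S) := \inf\Big\{\epsilon>0 : \text{there exist } k \le n \text{ and } y_1,\dots,y_k \in Y \text{ such that } S(U_X) \subseteq \bigcup_{i=1}^k U(y_i,\epsilon)\Big\}.$$ *)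

theory Defs
  imports "HOL-Analysis.Analysis"
begin

section \<open>Complex Hilbert spaces\<close>

class complex_vector = real_vector +
  fixes scaleC :: "complex \<Rightarrow> 'a \<Rightarrow> 'a"  (infixr \<open>*\<^sub>C\<close> 75)
  assumes scaleC_add_right: "a *\<^sub>C (x + y) = a *\<^sub>C x + a *\<^sub>C y"
    and scaleC_add_left: "(a + b) *\<^sub>C x = a *\<^sub>C x + b *\<^sub>C x"
    and scaleC_scaleC: "a *\<^sub>C (b *\<^sub>C x) = (a * b) *\<^sub>C x"
    and scaleC_one: "1 *\<^sub>C x = x"
    and scaleR_scaleC: "r *\<^sub>R x = complex_of_real r *\<^sub>C x"

text \<open>
  The inner product is linear in its first argument. The superclass \<^class>\<open>real_normed_vector\<close>
  supplies the norm, metric and topology; the last assumption makes them the ones induced by the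
  inner product.
\<close>

class complex_inner = complex_vector + real_normed_vector +
  fixes cinner :: "'a \<Rightarrow> 'a \<Rightarrow> complex"
  assumes cinner_commute: "cinner x y = cnj (cinner y x)"
    and cinner_add_left: "cinner (x + y) z = cinner x z + cinner y z"
    and cinner_scaleC_left: "cinner (a *\<^sub>C x) y = a * cinner x y"
    and cinner_nonneg: "cinner x x \<in> \<real>\<^sub>\<ge>\<^sub>0"
    and cinner_eq_zero_iff: "cinner x x = 0 \<longleftrightarrow> x = 0"
    and norm_eq_sqrt_cinner: "norm x = sqrt (Re (cinner x x))"

class chilbert_space = complex_inner + complete_space

instantiation complex :: chilbert_space
begin

definition scaleC_complex :: "complex \<Rightarrow> complex \<Rightarrow> complex"
  where "scaleC_complex a x = a * x"

definition cinner_complex :: "complex \<Rightarrow> complex \<Rightarrow> complex"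
  where "cinner_complex x y = x * cnj y"

instance
proof
  fix x :: complex
  show "cinner x x \<in> \<real>\<^sub>\<ge>\<^sub>0"
    unfolding cinner_complex_def complex_norm_square[symmetric] nonneg_Reals_of_real_iff by simp
  show "norm x = sqrt (Re (cinner x x))"
    by (simp add: cinner_complex_def cmod_def power2_eq_square)
qed (auto simp: scaleC_complex_def cinner_complex_def algebra_simps scaleR_conv_of_real)

end


section \<open>Bounded operators, adjoint and absolute value\<close>

definition clinear :: "('a::complex_vector \<Rightarrow> 'b::complex_vector) \<Rightarrow> bool"
  where "clinear T \<longleftrightarrow>
    (\<forall>x y. T (x + y) = T x + T y) \<and> (\<forall>a x. T (a *\<^sub>C x) = a *\<^sub>C T x)"

definition bounded_clinear :: "('a::complex_inner \<Rightarrow> 'b::complex_inner) \<Rightarrow> bool"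
  where "bounded_clinear T \<longleftrightarrow> clinear T \<and> (\<exists>K. \<forall>x. norm (T x) \<le> K * norm x)"

definition cadjoint :: "('a::complex_inner \<Rightarrow> 'b::complex_inner) \<Rightarrow> ('b \<Rightarrow> 'a)"
  where "cadjoint T = (THE S. bounded_clinear S \<and> (\<forall>x y. cinner (T x) y = cinner x (S y)))"

text \<open>
  Self-adjointness is not required separately: over the complex numbers it follows from the
  quadratic form being real.
\<close>

definition positive_op :: "('a::complex_inner \<Rightarrow> 'a) \<Rightarrow> bool"
  where "positive_op P \<longleftrightarrow> bounded_clinear P \<and> (\<forall>x. cinner (P x) x \<in> \<real>\<^sub>\<ge>\<^sub>0)"

definition abs_op :: "('a::complex_inner \<Rightarrow> 'b::complex_inner) \<Rightarrow> ('a \<Rightarrow> 'a)"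
  where "abs_op T = (THE P. positive_op P \<and> P \<circ> P = cadjoint T \<circ> T)"


section \<open>Entropy numbers\<close>

text \<open>Only meaningful for \<open>n \<ge> 1\<close>: for \<open>n = 0\<close> the infimum is over the empty set.\<close>

definition entropy_number ::
    "nat \<Rightarrow> ('a::real_normed_vector \<Rightarrow> 'b::real_normed_vector) \<Rightarrow> real"
  where "entropy_number n S =
    Inf {\<epsilon>. \<epsilon> > 0 \<and> (\<exists>k\<le>n. \<exists>y :: nat \<Rightarrow> 'b. S ` cball 0 1 \<subseteq> (\<Union>i\<in>{1..k}. cball (y i) \<epsilon>))}"

end

theory Submission
  imports Defs
begin

text \<open>
  Polar decomposition provides a contraction \<open>U\<close> with contractive adjoint \<open>V\<close> such that
  \<open>T = U |T|\<close> and \<open>|T| = V T\<close>; taking adjoints, \<open>T\<^sup>* = |T| V\<close> and \<open>|T| = T\<^sup>* U\<close>. Composing an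
  operator with a linear contraction on either side does not increase its entropy numbers, so these
  four identities give all the inequalities. The vector \<open>V y\<close> is the limit of \<open>|T| x\<^sub>n\<close> for any
  sequence such that \<open>T x\<^sub>n\<close> tends to the orthogonal projection of \<open>y\<close> onto the closure of the range
  of \<open>T\<close>.
\<close>

section \<open>Complex inner product spaces\<close>

text \<open>Makes bounded operators on a Hilbert space form a complete space, so that the operator
  iteration for the square root has a limit.\<close>

instance chilbert_space \<subseteq> banach ..

lemma cinner_self: "cinner x x = complex_of_real ((norm x)\<^sup>2)"
  for x :: "'a::complex_inner"
proof -
  have "Re (cinner x x) \<ge> 0" "Im (cinner x x) = 0"
    using cinner_nonneg[of x] by (auto simp: complex_nonneg_Reals_iff)
  moreover from this have "(norm x)\<^sup>2 = Re (cinner x x)"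
    by (simp add: norm_eq_sqrt_cinner)
  ultimately show ?thesis
    by (metis complex_is_Real_iff of_real_Re)
qed

lemma cinner_add_right: "cinner x (y + z) = cinner x y + cinner x z"
  for x :: "'a::complex_inner"
  by (metis cinner_add_left cinner_commute complex_cnj_add)

lemma cinner_scaleC_right: "cinner x (a *\<^sub>C y) = cnj a * cinner x y"
  for x :: "'a::complex_inner"
  by (metis cinner_commute cinner_scaleC_left complex_cnj_mult)

lemma norm_add_squared:
  "(norm (x + y))\<^sup>2 = (norm x)\<^sup>2 + 2 * Re (cinner x y) + (norm y)\<^sup>2"
  for x :: "'a::complex_inner"
proof -
  have "cinner (x + y) (x + y) = cinner x x + (cinner x y + cnj (cinner x y)) + cinner y y"
    by (simp add: cinner_add_left cinner_add_right flip: cinner_commute)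
  then have "complex_of_real ((norm (x + y))\<^sup>2)
      = complex_of_real ((norm x)\<^sup>2 + 2 * Re (cinner x y) + (norm y)\<^sup>2)"
    by (simp add: cinner_self complex_add_cnj)
  then show ?thesis
    using of_real_eq_iff by blast
qed

lemma norm_scaleC: "norm (a *\<^sub>C x) = cmod a * norm x"
  for x :: "'a::complex_inner"
proof -
  have "complex_of_real ((norm (a *\<^sub>C x))\<^sup>2) = a * cnj a * cinner x x"
    by (simp add: cinner_scaleC_left cinner_scaleC_right del: of_real_power flip: cinner_self)
  also have "\<dots> = complex_of_real ((cmod a * norm x)\<^sup>2)"
    by (simp add: cinner_self power_mult_distrib flip: complex_norm_square)
  finally show ?thesis
    by (metis norm_ge_zero mult_nonneg_nonneg of_real_eq_iff power2_eq_iff_nonneg)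
qed

text \<open>Pythagoras: the subtracted vector is the orthogonal projection of \<open>w\<close> onto
  the line spanned by \<open>z\<close>. Both Cauchy-Schwarz and the orthogonality of a nearest-point
  residual follow, since the left side is nonnegative or bounded below.\<close>

lemma norm_diff_projection:
  fixes w z :: "'a::complex_inner"
  assumes "z \<noteq> 0"
  shows "(norm (w - (cinner w z / cinner z z) *\<^sub>C z))\<^sup>2
    = (norm w)\<^sup>2 - (cmod (cinner w z) / norm z)\<^sup>2"
proof -
  define c where "c = - (cinner w z / cinner z z)"
  \<comment> \<open>The first instance gives \<open>c *\<^sub>C z + (- c) *\<^sub>C z\<close> as the
    multiple of \<open>z\<close> by 0; the second shows that this multiple vanishes.\<close>
  have *: "w - (cinner w z / cinner z z) *\<^sub>C z = w + c *\<^sub>C z"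
    using scaleC_add_left[of c "- c" z] scaleC_add_left[of 0 0 z]
    by (simp add: c_def eq_neg_iff_add_eq_0 algebra_simps)
  have "cinner w z * cnj (cinner w z) = (complex_of_real (cmod (cinner w z)))\<^sup>2"
    by (metis complex_norm_square of_real_power)
  then have "cnj c * cinner w z = - complex_of_real ((cmod (cinner w z) / norm z)\<^sup>2)"
    by (simp add: c_def cinner_self power_divide mult.commute)
  then have "Re (cinner w (c *\<^sub>C z)) = - (cmod (cinner w z) / norm z)\<^sup>2"
    by (simp add: cinner_scaleC_right)
  moreover have "norm (c *\<^sub>C z) = cmod (cinner w z) / norm z"
    using assms by (simp add: c_def norm_scaleC norm_divide norm_mult cinner_self power2_eq_square)
  ultimately show ?thesis
    unfolding * by (simp add: norm_add_squared)
qed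

lemma cauchy_schwarz: "cmod (cinner x y) \<le> norm x * norm y"
  for x :: "'a::complex_inner"
proof (cases "y = 0")
  case True
  then show ?thesis
    using cinner_add_right[of x 0 0] by simp
next
  case False
  have "(cmod (cinner x y) / norm y)\<^sup>2 \<le> (norm x)\<^sup>2"
    using norm_diff_projection[OF False, of x] by (metis diff_ge_0_iff_ge zero_le_power2)
  then have "cmod (cinner x y) / norm y \<le> norm x"
    by (rule power2_le_imp_le) simp
  then show ?thesis
    using False by (simp add: divide_le_eq)
qed

text \<open>Conjugation fixes real scalars, so the sesquilinear form is bilinear over the reals, and
  Cauchy-Schwarz bounds it with constant 1. This supplies the rules for differences and for
  limits.\<close>

interpretation cinner: bounded_bilinear "cinner :: 'a::complex_inner \<Rightarrow> 'a \<Rightarrow> complex"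
proof
  show "\<exists>K. \<forall>a b :: 'a. norm (cinner a b) \<le> norm a * norm b * K"
    by (intro exI[of _ 1]) (simp add: cauchy_schwarz)
qed (simp_all add: cinner_add_left cinner_add_right scaleR_scaleC cinner_scaleC_left
    cinner_scaleC_right scaleC_complex_def)

lemma bounded_linear_scaleC: "bounded_linear (\<lambda>x::'a::complex_inner. a *\<^sub>C x)"
proof
  show "\<exists>K. \<forall>x::'a. norm (a *\<^sub>C x) \<le> norm x * K"
    by (intro exI[of _ "cmod a"]) (simp add: norm_scaleC)
qed (simp_all add: scaleC_add_right scaleR_scaleC scaleC_scaleC mult.commute)

lemma cinner_eqI: "(\<And>z. cinner z x = cinner z y) \<Longrightarrow> x = y"
  for x :: "'a::complex_inner"
  by (metis cinner.diff_right cinner_eq_zero_iff eq_iff_diff_eq_0)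

lemma norm_diff_squared:
  "(norm (x - y))\<^sup>2 = (norm x)\<^sup>2 - 2 * Re (cinner x y) + (norm y)\<^sup>2"
  for x :: "'a::complex_inner"
  using norm_add_squared[of x "- y"] by (simp add: cinner.minus_right)

section \<open>Bounded complex-linear maps as real bounded linear maps\<close>

lemma bounded_clinear_imp_bounded_linear:
  assumes "bounded_clinear T"
  shows "bounded_linear T"
proof -
  obtain K where "\<And>x. norm (T x) \<le> K * norm x" and "clinear T"
    using assms unfolding bounded_clinear_def by blast
  then show ?thesis
    by (intro bounded_linear_intro[of _ K]) (simp_all add: clinear_def scaleR_scaleC mult.commute)
qed

lemma bounded_clinear_scaleC: "T (a *\<^sub>C x) = a *\<^sub>C T x" if "bounded_clinear T"
  using that by (simp add: bounded_clinear_def clinear_def)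

lemma bounded_clinearI:
  assumes "bounded_linear T" "\<And>a x. T (a *\<^sub>C x) = a *\<^sub>C T x"
  shows "bounded_clinear T"
proof -
  obtain K where "\<And>x. norm (T x) \<le> norm x * K"
    using bounded_linear.bounded[OF assms(1)] by blast
  then have "\<forall>x. norm (T x) \<le> K * norm x"
    by (simp add: mult.commute)
  then show ?thesis
    using assms(2) linear_add[OF bounded_linear.linear[OF assms(1)]]
    by (auto simp: bounded_clinear_def clinear_def)
qed

section \<open>Orthogonal projection and the adjoint\<close>

text \<open>\<open>M\<close> need not be closed, so the point nearest to \<open>y\<close> is sought
  in its closure, as the limit \<open>q\<close> of a minimizing sequence in \<open>M\<close>. The
  sequence is part of the result: later arguments transport it through a functional or lift it to
  preimages.\<close>

lemma clinear_subspace_projection: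
  fixes M :: "'a::chilbert_space set"
  assumes "0 \<in> M" and add: "\<And>u v. u \<in> M \<Longrightarrow> v \<in> M \<Longrightarrow> u + v \<in> M"
    and scale: "\<And>a u. u \<in> M \<Longrightarrow> a *\<^sub>C u \<in> M"
  obtains m q where "\<And>n::nat. m n \<in> M" "m \<longlonglongrightarrow> q" "\<And>z. z \<in> M \<Longrightarrow> cinner (y - q) z = 0"
proof -
  define d where "d = Inf ((\<lambda>z. (norm (y - z))\<^sup>2) ` M)"
  have bdd: "bdd_below ((\<lambda>z. (norm (y - z))\<^sup>2) ` M)"
    by (auto simp: bdd_below_def intro: exI[of _ 0])
  have d_le: "d \<le> (norm (y - z))\<^sup>2" if "z \<in> M" for z
    unfolding d_def by (rule cINF_lower[OF bdd that])
  have "\<exists>z\<in>M. (norm (y - z))\<^sup>2 < d + inverse (real (Suc n))" for n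
    using cINF_less_iff[OF _ bdd, of "d + inverse (real (Suc n))"] assms(1)
    by (auto simp: d_def)
  then obtain m where mM: "\<And>n. m n \<in> M"
    and m: "\<And>n. (norm (y - m n))\<^sup>2 < d + inverse (real (Suc n))"
    by metis
  \<comment> \<open>Parallelogram law for \<open>y - v\<close> and \<open>y - u\<close>; the
    midpoint of \<open>u\<close> and \<open>v\<close> lies in \<open>M\<close>, so its squared
    distance to \<open>y\<close> is at least \<open>d\<close>.\<close>
  have par: "(norm (u - v))\<^sup>2 \<le> 2 * (norm (y - u))\<^sup>2 + 2 * (norm (y - v))\<^sup>2 - 4 * d"
    if "u \<in> M" "v \<in> M" for u v
  proof -
    have "(norm (u - v))\<^sup>2 = (norm ((y - v) - (y - u)))\<^sup>2"
      by simp
    moreover have "(norm ((y - v) + (y - u)))\<^sup>2 = 4 * (norm (y - (1/2) *\<^sub>R (u + v)))\<^sup>2"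
    proof -
      have "(y - v) + (y - u) = 2 *\<^sub>R (y - (1/2) *\<^sub>R (u + v))"
        by (simp add: algebra_simps scaleR_2)
      then show ?thesis
        by (simp add: power_mult_distrib)
    qed
    moreover have "d \<le> (norm (y - (1/2) *\<^sub>R (u + v)))\<^sup>2"
      by (intro d_le) (simp add: that add scale scaleR_scaleC)
    ultimately show ?thesis
      using norm_add_squared[of "y - v" "y - u"] norm_diff_squared[of "y - v" "y - u"] by linarith
  qed
  have "Cauchy m"
  proof (rule metric_CauchyI)
    fix e :: real
    assume "e > 0"
    \<comment> \<open>In \<open>par\<close> the two excesses over \<open>d\<close> each carry a
      factor 2, so together they contribute at most four times the inverse of
      \<open>Suc N\<close>.\<close>
    then obtain N where N: "inverse (real (Suc N)) < e\<^sup>2 / 4"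
      using reals_Archimedean[of "e\<^sup>2 / 4"] by auto
    have "norm (m i - m j) < e" if "i \<ge> N" "j \<ge> N" for i j
    proof -
      have "inverse (real (Suc i)) \<le> inverse (real (Suc N))"
        "inverse (real (Suc j)) \<le> inverse (real (Suc N))"
        using that by (auto intro!: le_imp_inverse_le)
      then have "(norm (m i - m j))\<^sup>2 < e\<^sup>2"
        using par[OF mM mM, of i j] m[of i] m[of j] N by linarith
      then show ?thesis
        using \<open>e > 0\<close> by (simp add: power2_less_imp_less)
    qed
    then show "\<exists>N. \<forall>i\<ge>N. \<forall>j\<ge>N. dist (m i) (m j) < e"
      by (auto simp: dist_norm)
  qed
  then obtain q where q: "m \<longlonglongrightarrow> q"
    using Cauchy_convergent convergent_def by blast
  have "(norm (y - q))\<^sup>2 \<le> d"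
  proof (rule LIMSEQ_le)
    show "(\<lambda>n. (norm (y - m n))\<^sup>2) \<longlonglongrightarrow> (norm (y - q))\<^sup>2"
      by (intro tendsto_intros q)
    show "(\<lambda>n. d + inverse (real (Suc n))) \<longlonglongrightarrow> d"
      using tendsto_add[OF tendsto_const LIMSEQ_inverse_real_of_nat, of d] by simp
  qed (use m in \<open>auto intro: less_imp_le\<close>)
  have "cinner (y - q) z = 0" if "z \<in> M" for z
  proof (cases "z = 0")
    case True
    then show ?thesis
      by (simp add: cinner.zero_right)
  next
    case False
    \<comment> \<open>If the inner product were nonzero, moving from \<open>q\<close> by the
      projection of \<open>y - q\<close> onto \<open>z\<close> would bring the squared distance
      below \<open>d\<close>. The points \<open>m n + ?c *\<^sub>C z\<close> stay in
      \<open>M\<close>, which rules this out in the limit.\<close>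
    let ?c = "cinner (y - q) z / cinner z z"
    have "d \<le> (norm (y - q - ?c *\<^sub>C z))\<^sup>2"
    proof (rule LIMSEQ_le_const)
      show "(\<lambda>n. (norm (y - m n - ?c *\<^sub>C z))\<^sup>2) \<longlonglongrightarrow> (norm (y - q - ?c *\<^sub>C z))\<^sup>2"
        by (intro tendsto_intros q)
      show "\<exists>N. \<forall>n\<ge>N. d \<le> (norm (y - m n - ?c *\<^sub>C z))\<^sup>2"
        using d_le[OF add[OF mM scale[OF that]]] by (simp add: diff_diff_add)
    qed
    then have "(cmod (cinner (y - q) z) / norm z)\<^sup>2 \<le> 0"
      using norm_diff_projection[OF False, of "y - q"] \<open>(norm (y - q))\<^sup>2 \<le> d\<close> by linarith
    then show ?thesis
      using False by simp
  qed
  then show thesis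
    using that mM q by blast
qed

section \<open>Riesz representation and the Hilbert adjoint\<close>

lemma riesz_representation:
  fixes f :: "'a::chilbert_space \<Rightarrow> complex"
  assumes "bounded_linear f" and scale: "\<And>a x. f (a *\<^sub>C x) = a * f x"
  obtains v where "\<And>x. f x = cinner x v"
proof (cases "\<forall>x. f x = 0")
  case True
  then show thesis
    using that[of 0] by (simp add: cinner.zero_right)
next
  case False
  interpret f: bounded_linear f by fact
  from False obtain y where "f y \<noteq> 0"
    by blast
  \<comment> \<open>Project \<open>y\<close> onto the kernel of \<open>f\<close>; the residual
    \<open>w\<close> is orthogonal to the kernel and, as the kernel is closed under limits,
    satisfies \<open>f w = f y\<close>.\<close>
  obtain m q where m: "\<And>n::nat. m n \<in> {x. f x = 0}" and q: "m \<longlonglongrightarrow> q"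
    and orth: "\<And>z. z \<in> {x. f x = 0} \<Longrightarrow> cinner (y - q) z = 0"
    by (rule clinear_subspace_projection[of "{x. f x = 0}" y])
      (auto simp: f.zero f.add scale)
  have "f q = 0"
    using LIMSEQ_unique[OF f.tendsto[OF q]] m by simp
  define w where "w = y - q"
  have "f w \<noteq> 0"
    using \<open>f y \<noteq> 0\<close> \<open>f q = 0\<close> by (simp add: w_def f.diff)
  then have "w \<noteq> 0"
    by (auto simp: f.zero)
  have "f x = cinner x (cnj (f w / cinner w w) *\<^sub>C w)" for x
  proof -
    \<comment> \<open>The vector \<open>x - (f x / f w) *\<^sub>C w\<close> lies in the kernel of
      \<open>f\<close>; solving the orthogonality relation for \<open>f x\<close> yields the
      representing multiple of \<open>w\<close>.\<close>
    have "cinner w (x - (f x / f w) *\<^sub>C w) = 0"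
      unfolding w_def[symmetric] using orth \<open>f w \<noteq> 0\<close> by (simp add: w_def[symmetric] f.diff scale)
    then have "cinner (x - (f x / f w) *\<^sub>C w) w = 0"
      by (metis cinner_commute complex_cnj_zero)
    then have "cinner x w = f x / f w * cinner w w"
      by (simp add: cinner.diff_left cinner_scaleC_left)
    then show ?thesis
      using \<open>f w \<noteq> 0\<close> \<open>w \<noteq> 0\<close> by (simp add: cinner_scaleC_right cinner_eq_zero_iff)
  qed
  then show thesis
    by (rule that)
qed

text \<open>Testing the adjoint relation at \<open>x = S y\<close> expresses the square of
  \<open>norm (S y)\<close> through \<open>T (S y)\<close>; one factor \<open>norm (S y)\<close>
  then cancels.\<close>

lemma norm_adjoint_le:
  fixes T :: "'a::complex_inner \<Rightarrow> 'b::complex_inner"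
  assumes adj: "\<And>x y. cinner (T x) y = cinner x (S y)"
    and "K \<ge> 0" and K: "\<And>x. norm (T x) \<le> K * norm x"
  shows "norm (S y) \<le> K * norm y"
proof (cases "S y = 0")
  case False
  have "(norm (S y))\<^sup>2 = cmod (cinner (T (S y)) y)"
    by (simp add: adj cinner_self norm_power)
  also have "\<dots> \<le> norm (T (S y)) * norm y"
    by (rule cauchy_schwarz)
  also have "\<dots> \<le> (K * norm (S y)) * norm y"
    by (intro mult_right_mono K norm_ge_zero)
  finally have "norm (S y) * norm (S y) \<le> norm (S y) * (K * norm y)"
    by (simp add: power2_eq_square mult_ac)
  then show ?thesis
    using False by simp
qed (simp add: \<open>K \<ge> 0\<close>)

text \<open>Riesz representation of \<open>\<lambda>x. cinner (T x) y\<close> gives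
  \<open>S y\<close> pointwise. Linearity of \<open>S\<close> follows because a vector is determined
  by its inner products.\<close>

lemma adjoint_exists:
  fixes T :: "'a::chilbert_space \<Rightarrow> 'b::complex_inner"
  assumes "bounded_clinear T"
  obtains S where "bounded_clinear S" "\<And>x y. cinner (T x) y = cinner x (S y)"
proof -
  interpret T: bounded_linear T
    by (rule bounded_clinear_imp_bounded_linear) fact
  have "\<exists>v. \<forall>x. cinner (T x) y = cinner x v" for y
    by (rule riesz_representation[of "\<lambda>x. cinner (T x) y"])
      (auto simp: bounded_clinear_scaleC[OF assms] cinner_scaleC_left
        intro: bounded_linear_compose[OF cinner.bounded_linear_left T.bounded_linear])
  then obtain S where S: "\<And>x y. cinner (T x) y = cinner x (S y)"
    by metis
  obtain K where "K \<ge> 0" and K: "\<And>x. norm (T x) \<le> norm x * K"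
    using T.nonneg_bounded by blast
  have "bounded_clinear S"
    unfolding bounded_clinear_def clinear_def
  proof (intro conjI allI exI)
    show "S (x + y) = S x + S y" for x y
      by (rule cinner_eqI) (simp add: cinner_add_right flip: S)
    show "S (a *\<^sub>C x) = a *\<^sub>C S x" for a x
      by (rule cinner_eqI) (simp add: cinner_scaleC_right flip: S)
    show "norm (S y) \<le> K * norm y" for y
      using norm_adjoint_le[OF S \<open>K \<ge> 0\<close>] K by (simp add: mult.commute)
  qed
  then show thesis
    using that S by blast
qed

lemma cadjoint_eqI:
  assumes "bounded_clinear S" "\<And>x y. cinner (T x) y = cinner x (S y)"
  shows "cadjoint T = S"
  unfolding cadjoint_def
proof (rule the_equality)
  show "R = S" if "bounded_clinear R \<and> (\<forall>x y. cinner (T x) y = cinner x (R y))" for R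
    using that assms(2) by (metis cinner_eqI ext)
qed (use assms in simp)

lemma bounded_clinear_cadjoint:
  fixes T :: "'a::chilbert_space \<Rightarrow> 'b::complex_inner"
  assumes "bounded_clinear T"
  shows "bounded_clinear (cadjoint T)"
  by (metis adjoint_exists assms cadjoint_eqI)

lemma cinner_cadjoint:
  fixes T :: "'a::chilbert_space \<Rightarrow> 'b::complex_inner"
  assumes "bounded_clinear T"
  shows "cinner (T x) y = cinner x (cadjoint T y)"
  by (metis adjoint_exists assms cadjoint_eqI)

lemma cinner_cadjoint_left:
  fixes T :: "'a::chilbert_space \<Rightarrow> 'b::complex_inner"
  assumes "bounded_clinear T"
  shows "cinner (cadjoint T y) x = cinner y (T x)"
  by (metis assms cinner_cadjoint cinner_commute)

section \<open>Positive square roots\<close>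

text \<open>
  The norms of the increments of the iteration \<open>Y \<mapsto> (B + Y\<^sup>2) / 2\<close> are dominated by the increments of
  the scalar iteration \<open>s \<mapsto> (1 + s\<^sup>2) / 2\<close>, which increases to \<open>1\<close>; hence it converges in norm.
\<close>

lemma quadratic_iteration_fixpoint:
  fixes B :: "'a::banach \<Rightarrow>\<^sub>L 'a"
  assumes "norm B \<le> 1"
  obtains y Y where "y 0 = 0" "\<And>n. y (Suc n) = (1/2) *\<^sub>R (B + (y n o\<^sub>L y n))" "y \<longlonglongrightarrow> Y"
    "norm Y \<le> 1" "2 *\<^sub>R Y = B + (Y o\<^sub>L Y)"
proof -
  interpret blinfun_compose: bounded_bilinear "(o\<^sub>L) :: ('a \<Rightarrow>\<^sub>L 'a) \<Rightarrow> ('a \<Rightarrow>\<^sub>L 'a) \<Rightarrow> ('a \<Rightarrow>\<^sub>L 'a)"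
    by (rule bounded_bilinear_blinfun_compose)
  define y where "y = rec_nat 0 (\<lambda>_ Z. (1/2) *\<^sub>R (B + (Z o\<^sub>L Z)))"
  have y0: "y 0 = 0" and ySuc: "y (Suc n) = (1/2) *\<^sub>R (B + (y n o\<^sub>L y n))" for n
    by (simp_all add: y_def)
  define s where "s = rec_nat 0 (\<lambda>_ t. (1 + t\<^sup>2) / (2::real))"
  have s0: "s 0 = 0" and sSuc: "s (Suc n) = (1 + (s n)\<^sup>2) / 2" for n
    by (simp_all add: s_def)
  have s_bounds: "0 \<le> s n \<and> s n \<le> 1" for n
  proof (induction n)
    case (Suc n)
    then have "(s n)\<^sup>2 \<le> 1"
      by (simp add: power_le_one)
    then show ?case
      by (simp add: sSuc)
  qed (simp add: s0)
  have s_mono: "s n \<le> s (Suc n)" for n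
    \<comment> \<open>The increment of \<open>s\<close> is half the square of
      \<open>s n - 1\<close>.\<close>
    using zero_le_power2[of "s n - 1"] by (simp add: sSuc power2_diff)
  have "incseq s"
    by (rule incseq_SucI) (rule s_mono)
  then have "convergent s"
    using incseq_convergent[of s 1] s_bounds by (metis convergent_def)
  then have sum_s: "summable (\<lambda>n. s (Suc n) - s n)"
    by (auto simp: convergent_def intro: telescope_summable)
  have norm_y: "norm (y n) \<le> s n" for n
  proof (induction n)
    case (Suc n)
    have "norm (y n o\<^sub>L y n) \<le> (s n)\<^sup>2"
      using norm_blinfun_compose[of "y n" "y n"] Suc mult_mono[OF Suc Suc] s_bounds[of n]
      by (simp add: power2_eq_square)
    then have "norm (B + (y n o\<^sub>L y n)) \<le> 1 + (s n)\<^sup>2"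
      using norm_triangle_ineq[of B "y n o\<^sub>L y n"] assms by linarith
    then show ?case
      by (simp add: ySuc sSuc)
  qed (simp add: y0 s0)
  have increment: "norm (y (Suc n) - y n) \<le> s (Suc n) - s n" for n
  proof (induction n)
    case 0
    then show ?case
      using norm_y[of 1] by (simp add: y0 s0)
  next
    case (Suc n)
    let ?d = "y (Suc n) - y n"
    \<comment> \<open>A difference of squares is split without commuting the factors: a a - b b = a
      (a - b) + (a - b) b. The scalar sequence satisfies the same identity, so the bounds match term
      by term.\<close>
    have "y (Suc (Suc n)) - y (Suc n) = (1/2) *\<^sub>R ((y (Suc n) o\<^sub>L ?d) + (?d o\<^sub>L y n))"
      by (simp only: ySuc[of "Suc n"], subst (2) ySuc)
        (auto simp: blinfun_compose.diff_left blinfun_compose.diff_right algebra_simps)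
    then have "norm (y (Suc (Suc n)) - y (Suc n))
        = (1/2) * norm ((y (Suc n) o\<^sub>L ?d) + (?d o\<^sub>L y n))"
      by simp
    also have "\<dots> \<le> (1/2) * (norm (y (Suc n)) * norm ?d + norm ?d * norm (y n))"
      by (intro mult_left_mono order.trans[OF norm_triangle_ineq] add_mono norm_blinfun_compose) simp
    also have "\<dots> \<le> (1/2) * (s (Suc n) * (s (Suc n) - s n) + (s (Suc n) - s n) * s n)"
      using Suc norm_y s_bounds s_mono
      by (intro mult_left_mono add_mono mult_mono) auto
    also have "\<dots> = s (Suc (Suc n)) - s (Suc n)"
      by (simp only: sSuc[of "Suc n"], subst (5) sSuc) (simp add: field_simps power2_eq_square)
    finally show ?case .
  qed
  have "summable (\<lambda>n. y (Suc n) - y n)"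
    by (rule summable_comparison_test[OF _ sum_s]) (use increment in auto)
  then have "convergent (\<lambda>n. \<Sum>k<n. y (Suc k) - y k)"
    by (simp add: summable_iff_convergent)
  then obtain Y where Y: "y \<longlonglongrightarrow> Y"
    by (auto simp: sum_lessThan_telescope y0 convergent_def)
  have "norm (y n) \<le> 1" for n
    using norm_y s_bounds by (meson order.trans)
  then have "norm Y \<le> 1"
    by (intro LIMSEQ_le_const2[OF tendsto_norm[OF Y]]) auto
  moreover have "2 *\<^sub>R Y = B + (Y o\<^sub>L Y)"
  proof (rule LIMSEQ_unique)
    show "(\<lambda>n. 2 *\<^sub>R y (Suc n)) \<longlonglongrightarrow> 2 *\<^sub>R Y"
      by (intro tendsto_intros LIMSEQ_Suc Y)
    show "(\<lambda>n. 2 *\<^sub>R y (Suc n)) \<longlonglongrightarrow> B + (Y o\<^sub>L Y)"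
      by (simp add: ySuc) (intro tendsto_intros blinfun_compose.tendsto Y)
  qed
  ultimately show thesis
    using that y0 ySuc Y by blast
qed


section \<open>Positive operators and their square roots\<close>

lemma positive_op_selfadjoint:
  assumes "positive_op P"
  shows "cinner (P x) z = cinner x (P z)"
proof -
  have bcl: "bounded_clinear P"
    using assms by (simp add: positive_op_def)
  interpret P: bounded_linear P
    by (rule bounded_clinear_imp_bounded_linear) fact
  have real: "Im (cinner (P u) u) = 0" for u
    using assms by (simp add: positive_op_def complex_nonneg_Reals_iff)
  \<comment> \<open>Polarization: the quadratic form is real at \<open>u + v\<close>,
    \<open>u\<close> and \<open>v\<close>, so the imaginary parts of the cross terms cancel.
    Replacing \<open>z\<close> by i times \<open>z\<close> below turns this into equality of real
    parts.\<close>
  have Im_eq: "Im (cinner (P u) v) = Im (cinner u (P v))" for u v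
  proof -
    have "Im (cinner (P u) v) + Im (cinner (P v) u) = 0"
      using real[of "u + v"] real[of u] real[of v]
      by (simp add: P.add cinner_add_left cinner_add_right)
    then show ?thesis
      using arg_cong[OF cinner_commute[of "P v" u], of Im] by simp
  qed
  have "Re (cinner (P x) z) = Re (cinner x (P z))"
    using Im_eq[of x "\<i> *\<^sub>C z"] by (simp add: bounded_clinear_scaleC[OF bcl] cinner_scaleC_right)
  with Im_eq show ?thesis
    by (simp add: complex_eq_iff)
qed

lemma positive_op_eq_zeroI:
  assumes "positive_op P" "cinner (P y) y = 0"
  shows "P y = 0"
proof (rule ccontr)
  assume "P y \<noteq> 0"
  interpret P: bounded_linear P
    using assms(1) by (simp add: positive_op_def bounded_clinear_imp_bounded_linear)
  have nonneg: "Re (cinner (P u) u) \<ge> 0" for u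
    using assms(1) by (simp add: positive_op_def complex_nonneg_Reals_iff)
  define a where "a = (norm (P y))\<^sup>2"
  define r where "r = Re (cinner (P (P y)) (P y))"
  \<comment> \<open>Along \<open>y + t *\<^sub>R P y\<close> the form equals
    \<open>2 * t * a + t * t * r\<close>, which is negative for small negative \<open>t\<close>. The
    denominator \<open>r + 1\<close> keeps the choice valid when \<open>r = 0\<close>.\<close>
  define t where "t = - (a / (r + 1))"
  have "a > 0" "r \<ge> 0"
    using \<open>P y \<noteq> 0\<close> nonneg by (simp_all add: a_def r_def)
  have "0 \<le> Re (cinner (P (y + t *\<^sub>R P y)) (y + t *\<^sub>R P y))"
    by (rule nonneg)
  also have "\<dots> = 2 * t * a + t * t * r"
    using assms(2) positive_op_selfadjoint[OF assms(1), of "P y" y]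
    by (simp add: P.add P.scaleR cinner.add_left cinner.add_right cinner.scaleR_left
        cinner.scaleR_right cinner_self a_def r_def algebra_simps)
  also have "\<dots> = - (a * a * (r + 2) / (r + 1)\<^sup>2)"
  proof -
    define u where "u = r + 1"
    have "u \<noteq> 0" and r: "r = u - 1"
      using \<open>r \<ge> 0\<close> by (simp_all add: u_def)
    then show ?thesis
      unfolding t_def r by (simp add: field_simps power2_eq_square)
  qed
  also have "\<dots> < 0"
    using \<open>a > 0\<close> \<open>r \<ge> 0\<close> by simp
  finally show False
    by simp
qed

text \<open>With B = I - T*T / K^2, the fixpoint equation 2 Y = B + Y^2 says (I - Y)^2 = I - B = T*T
  / K^2, so P = K (I - Y) is a root. The commutation property serves for complex linearity of
  \<open>P\<close> and for uniqueness.\<close>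

lemma positive_sqrt_exists:
  fixes T :: "'a::chilbert_space \<Rightarrow> 'b::complex_inner"
  assumes T: "bounded_clinear T"
  obtains P where "positive_op P" "P \<circ> P = cadjoint T \<circ> T"
    "\<And>C x. bounded_linear C \<Longrightarrow> (\<And>x. C (cadjoint T (T x)) = cadjoint T (T (C x))) \<Longrightarrow> C (P x) = P (C x)"
proof -
  note T' = bounded_clinear_cadjoint[OF T]
  interpret T: bounded_linear T
    by (rule bounded_clinear_imp_bounded_linear) fact
  interpret T': bounded_linear "cadjoint T"
    by (rule bounded_clinear_imp_bounded_linear) fact
  obtain K where "K > 0" and K: "\<And>x. norm (T x) \<le> K * norm x"
    using T.pos_bounded by (metis mult.commute)
  define Bf where "Bf x = x - (1 / K\<^sup>2) *\<^sub>R cadjoint T (T x)" for x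
  have Bf: "bounded_linear Bf"
    unfolding Bf_def
    by (intro bounded_linear_sub bounded_linear_ident bounded_linear_scaleR_right
        bounded_linear_compose[OF bounded_linear_scaleR_right]
        bounded_linear_compose[OF T'.bounded_linear T.bounded_linear])
  define B where "B = Blinfun Bf"
  have B: "blinfun_apply B x = x - (1 / K\<^sup>2) *\<^sub>R cadjoint T (T x)" for x
    by (simp add: B_def bounded_linear_Blinfun_apply[OF Bf] Bf_def)
  \<comment> \<open>In the expanded square the mixed term is -2 |Tx|^2 / K^2, while the last term is
    at most |Tx|^2 / K^2.\<close>
  have "norm (blinfun_apply B x) \<le> norm x" for x
  proof (rule power2_le_imp_le)
    have "(norm (cadjoint T (T x)))\<^sup>2 \<le> K\<^sup>2 * (norm (T x))\<^sup>2"
      using norm_adjoint_le[OF cinner_cadjoint[OF T] _ K, of "T x"] \<open>K > 0\<close>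
      by (metis less_imp_le norm_ge_zero power_mono power_mult_distrib)
    then have "(norm ((1 / K\<^sup>2) *\<^sub>R cadjoint T (T x)))\<^sup>2 \<le> (1 / K\<^sup>2) * (norm (T x))\<^sup>2"
      using \<open>K > 0\<close> by (simp add: power_mult_distrib power_divide field_simps power2_eq_square)
    moreover have "Re (cinner x ((1 / K\<^sup>2) *\<^sub>R cadjoint T (T x))) = (1 / K\<^sup>2) * (norm (T x))\<^sup>2"
      by (simp add: cinner.scaleR_right cinner_self flip: cinner_cadjoint[OF T])
    moreover have "(1 / K\<^sup>2) * (norm (T x))\<^sup>2 \<ge> 0"
      by simp
    ultimately show "(norm (blinfun_apply B x))\<^sup>2 \<le> (norm x)\<^sup>2"
      unfolding B norm_diff_squared by linarith
  qed simp
  then have "norm B \<le> 1"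
    by (intro norm_blinfun_bound) simp_all
  \<comment> \<open>The iterates are retained because they are built from \<open>B\<close> by sums,
    real multiples and composition: commutation and symmetry hold for each by induction and pass to
    the limit \<open>Y\<close>.\<close>
  then obtain y Y where y0: "y 0 = 0" and ySuc: "\<And>n. y (Suc n) = (1/2) *\<^sub>R (B + (y n o\<^sub>L y n))"
    and Y: "y \<longlonglongrightarrow> Y" "norm Y \<le> 1" and fixpoint: "2 *\<^sub>R Y = B + (Y o\<^sub>L Y)"
    by (rule quadratic_iteration_fixpoint) blast
  have Y_lim: "(\<lambda>n. blinfun_apply (y n) x) \<longlonglongrightarrow> blinfun_apply Y x" for x
    by (intro blinfun.tendsto Y tendsto_const)
  have Y_commute: "C (blinfun_apply Y x) = blinfun_apply Y (C x)"
    if C: "bounded_linear C" and "\<And>x. C (cadjoint T (T x)) = cadjoint T (T (C x))" for C x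
  proof -
    interpret C: bounded_linear C by fact
    have "C (blinfun_apply (y n) x) = blinfun_apply (y n) (C x)" for n x
      by (induction n arbitrary: x)
        (simp_all add: y0 ySuc B blinfun.add_left blinfun.scaleR_left C.zero C.add C.diff C.scaleR that(2))
    then have "(\<lambda>n. C (blinfun_apply (y n) x)) \<longlonglongrightarrow> blinfun_apply Y (C x)"
      using Y_lim by simp
    with C.tendsto[OF Y_lim] show ?thesis
      by (rule LIMSEQ_unique)
  qed
  have Y_selfadjoint: "cinner (blinfun_apply Y x) z = cinner x (blinfun_apply Y z)" for x z
  proof (rule LIMSEQ_unique)
    have "cinner (blinfun_apply (y n) x) z = cinner x (blinfun_apply (y n) z)" for n x z
      by (induction n arbitrary: x z)
        (simp_all add: y0 ySuc B blinfun.add_left blinfun.scaleR_left cinner.zero_left cinner.zero_right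
          cinner.add_left cinner.add_right cinner.diff_left cinner.diff_right cinner.scaleR_left
          cinner.scaleR_right cinner_cadjoint_left[OF T] cinner_cadjoint[OF T, symmetric])
    then show "(\<lambda>n. cinner (blinfun_apply (y n) x) z) \<longlonglongrightarrow> cinner x (blinfun_apply Y z)"
      using cinner.tendsto[OF tendsto_const Y_lim] by simp
    show "(\<lambda>n. cinner (blinfun_apply (y n) x) z) \<longlonglongrightarrow> cinner (blinfun_apply Y x) z"
      by (rule cinner.tendsto[OF Y_lim tendsto_const])
  qed
  define P where "P x = K *\<^sub>R (x - blinfun_apply Y x)" for x
  have P_commute: "C (P x) = P (C x)"
    if "bounded_linear C" "\<And>x. C (cadjoint T (T x)) = cadjoint T (T (C x))" for C x
  proof -
    interpret C: bounded_linear C by fact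
    have "C (blinfun_apply Y x) = blinfun_apply Y (C x)"
      using that by (rule Y_commute)
    then show ?thesis
      by (simp add: P_def C.diff C.scaleR)
  qed
  have P_square: "P (P x) = cadjoint T (T x)" for x
  proof -
    have "2 *\<^sub>R blinfun_apply Y x = blinfun_apply B x + blinfun_apply Y (blinfun_apply Y x)"
      using arg_cong[OF fixpoint, of "\<lambda>Z. blinfun_apply Z x"]
      by (simp add: blinfun.add_left blinfun.scaleR_left)
    then have "blinfun_apply Y (blinfun_apply Y x)
        = 2 *\<^sub>R blinfun_apply Y x - x + (1 / K\<^sup>2) *\<^sub>R cadjoint T (T x)"
      by (simp add: B algebra_simps)
    then have *: "x - 2 *\<^sub>R blinfun_apply Y x + blinfun_apply Y (blinfun_apply Y x)
        = (1 / K\<^sup>2) *\<^sub>R cadjoint T (T x)"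
      by simp
    have "P (P x) = K\<^sup>2 *\<^sub>R (x - 2 *\<^sub>R blinfun_apply Y x + blinfun_apply Y (blinfun_apply Y x))"
      by (simp add: P_def blinfun.diff_right blinfun.scaleR_right scaleR_2 algebra_simps power2_eq_square)
    then show ?thesis
      using \<open>K > 0\<close> by (simp add: *)
  qed
  have "positive_op P"
    unfolding positive_op_def
  proof (intro conjI allI)
    show "bounded_clinear P"
    proof (rule bounded_clinearI)
      show "bounded_linear P"
        unfolding P_def
        by (intro bounded_linear_compose[OF bounded_linear_scaleR_right] bounded_linear_sub
            bounded_linear_ident blinfun.bounded_linear_right)
      \<comment> \<open>Scalar multiplication by \<open>a\<close> is a real bounded linear map
        commuting with \<open>cadjoint T \<circ> T\<close>, hence with \<open>P\<close>.\<close>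
      show "P (a *\<^sub>C x) = a *\<^sub>C P x" for a x
        by (rule P_commute[symmetric])
          (simp_all add: bounded_linear_scaleC bounded_clinear_scaleC[OF T] bounded_clinear_scaleC[OF T'])
    qed
    fix x
    \<comment> \<open>Positivity of I - Y: the real part is controlled by
      \<open>norm Y \<le> 1\<close>, the imaginary part vanishes by symmetry of
      \<open>Y\<close>.\<close>
    have "cmod (cinner (blinfun_apply Y x) x) \<le> norm (blinfun_apply Y x) * norm x"
      by (rule cauchy_schwarz)
    also have "norm (blinfun_apply Y x) \<le> norm x"
      using norm_blinfun[of Y x] mult_right_mono[OF Y(2) norm_ge_zero[of x]] by simp
    then have "norm (blinfun_apply Y x) * norm x \<le> (norm x)\<^sup>2"
      by (simp add: power2_eq_square mult_right_mono)
    finally have "Re (cinner (blinfun_apply Y x) x) \<le> (norm x)\<^sup>2"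
      using complex_Re_le_cmod order.trans by blast
    moreover have "Im (cinner (blinfun_apply Y x) x) = 0"
      using arg_cong[OF cinner_commute[of "blinfun_apply Y x" x], of Im] Y_selfadjoint[of x x] by simp
    ultimately show "cinner (P x) x \<in> \<real>\<^sub>\<ge>\<^sub>0"
      using \<open>K > 0\<close>
      by (simp add: P_def cinner.scaleR_left cinner.diff_left cinner_self complex_nonneg_Reals_iff
          del: of_real_power)
  qed
  then show thesis
  proof (rule that)
    show "P \<circ> P = cadjoint T \<circ> T"
      by (simp add: fun_eq_iff P_square)
    show "C (P x) = P (C x)"
      if "bounded_linear C" "\<And>x. C (cadjoint T (T x)) = cadjoint T (T (C x))" for C x
      using that by (rule P_commute)
  qed
qed

text \<open>For y = (Q - P) x, commutation gives (P + Q) y = (Q^2 - P^2) x = 0. Two nonnegative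
  forms then sum to zero at \<open>y\<close>, so \<open>P\<close> and \<open>Q\<close> both kill
  \<open>y\<close>, and |y|^2 is the inner product of x and (Q - P) y, hence 0.\<close>

lemma positive_sqrt_unique:
  assumes P: "positive_op P" and Q: "positive_op Q"
    and eq: "Q \<circ> Q = P \<circ> P" and commute: "\<And>x. Q (P x) = P (Q x)"
  shows "Q = P"
proof
  fix x
  interpret P: bounded_linear P
    using P by (simp add: positive_op_def bounded_clinear_imp_bounded_linear)
  interpret Q: bounded_linear Q
    using Q by (simp add: positive_op_def bounded_clinear_imp_bounded_linear)
  define y where "y = Q x - P x"
  have "P y + Q y = 0"
    using fun_cong[OF eq, of x] by (simp add: y_def P.diff Q.diff commute)
  then have "cinner (P y) y + cinner (Q y) y = 0"
    by (simp add: cinner.zero_left flip: cinner_add_left)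
  moreover have "cinner (P y) y \<in> \<real>\<^sub>\<ge>\<^sub>0" "cinner (Q y) y \<in> \<real>\<^sub>\<ge>\<^sub>0"
    using P Q by (simp_all add: positive_op_def)
  ultimately have "cinner (P y) y = 0" "cinner (Q y) y = 0"
    by (auto simp: complex_nonneg_Reals_iff complex_eq_iff)
  then have "P y = 0" "Q y = 0"
    using positive_op_eq_zeroI P Q by blast+
  have "cinner y y = cinner x (Q y - P y)"
    by (simp add: y_def cinner.diff_left cinner.diff_right positive_op_selfadjoint[OF P]
        positive_op_selfadjoint[OF Q] P.diff Q.diff)
  then have "cinner y y = 0"
    by (simp add: \<open>P y = 0\<close> \<open>Q y = 0\<close> cinner.zero_right)
  then show "Q x = P x"
    by (simp add: cinner_eq_zero_iff y_def)
qed

text \<open>Any positive root \<open>Q\<close> commutes with its own square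
  \<open>cadjoint T \<circ> T\<close>, hence with the constructed root \<open>P\<close>. Uniqueness
  among commuting roots thus settles the definite description in \<open>abs_op\<close>.\<close>

lemma abs_op_properties:
  fixes T :: "'a::chilbert_space \<Rightarrow> 'b::complex_inner"
  assumes "bounded_clinear T"
  shows "positive_op (abs_op T)" "abs_op T \<circ> abs_op T = cadjoint T \<circ> T"
proof -
  obtain P where P: "positive_op P" "P \<circ> P = cadjoint T \<circ> T"
    and commute: "\<And>C x. bounded_linear C \<Longrightarrow> (\<And>x. C (cadjoint T (T x)) = cadjoint T (T (C x)))
      \<Longrightarrow> C (P x) = P (C x)"
    by (rule positive_sqrt_exists[OF assms]) blast
  have unique: "Q = P" if Q: "positive_op Q" "Q \<circ> Q = cadjoint T \<circ> T" for Q
  proof (rule positive_sqrt_unique)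
    have "cadjoint T (T x) = Q (Q x)" for x
      using fun_cong[OF Q(2), of x] by simp
    moreover have "bounded_linear Q"
      using Q(1) by (simp add: positive_op_def bounded_clinear_imp_bounded_linear)
    ultimately show "Q (P x) = P (Q x)" for x
      by (simp add: commute)
  qed (use P Q in simp_all)
  have "abs_op T = P"
    unfolding abs_op_def
  proof (rule the_equality)
    show "Q = P" if "positive_op Q \<and> Q \<circ> Q = cadjoint T \<circ> T" for Q
      using that by (intro unique) blast+
  qed (use P in blast)
  with P show "positive_op (abs_op T)" "abs_op T \<circ> abs_op T = cadjoint T \<circ> T"
    by simp_all
qed

section \<open>Polar decomposition and entropy numbers\<close>

text \<open>Equal Gram forms make \<open>A x \<mapsto> B x\<close> a well-defined isometry between
  the ranges; \<open>V\<close> is its continuous extension to the closure, preceded by the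
  orthogonal projection.\<close>

lemma equal_gram_contraction:
  fixes A :: "'a::complex_inner \<Rightarrow> 'b::chilbert_space" and B :: "'a \<Rightarrow> 'c::chilbert_space"
  assumes A: "bounded_clinear A" and B: "bounded_clinear B"
    and gram: "\<And>x z. cinner (A x) (A z) = cinner (B x) (B z)"
  obtains V where "bounded_clinear V" "\<And>y. norm (V y) \<le> norm y" "\<And>x. V (A x) = B x"
    "\<And>x y. cinner (B x) (V y) = cinner (A x) y"
proof -
  interpret A: bounded_linear A
    by (rule bounded_clinear_imp_bounded_linear) fact
  interpret B: bounded_linear B
    by (rule bounded_clinear_imp_bounded_linear) fact
  have norm_eq: "norm (A x) = norm (B x)" for x
    using gram[of x x] by (simp add: norm_eq_sqrt_cinner)
  \<comment> \<open>\<open>N\<close> is the orthogonal complement of the range of \<open>B\<close>.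
    Being orthogonal to \<open>N\<close> and having prescribed inner products with that range
    determines a vector, because the difference of two candidates lies in \<open>N\<close> and is
    orthogonal to it. Linearity of \<open>V\<close> is read off from this, with no reference to the
    chosen sequences.\<close>
  define N where "N = {w. \<forall>x. cinner (B x) w = 0}"
  have char_unique: "v = v'"
    if "\<And>w. w \<in> N \<Longrightarrow> cinner v w = 0" "\<And>w. w \<in> N \<Longrightarrow> cinner v' w = 0"
      "\<And>x. cinner (B x) v = cinner (B x) v'" for v v'
  proof -
    have "v - v' \<in> N"
      using that(3) by (simp add: N_def cinner.diff_right)
    then have "cinner (v - v') (v - v') = 0"
      using that(1,2) by (simp add: cinner.diff_left)
    then show ?thesis
      by (simp add: cinner_eq_zero_iff)
  qed
  have "\<exists>v. norm v \<le> norm y \<and> (\<forall>w\<in>N. cinner v w = 0) \<and> (\<forall>x. cinner (B x) v = cinner (A x) y)" for y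
  proof -
    have zero: "0 \<in> range A"
      using A.zero by (metis rangeI)
    have add: "u + v \<in> range A" if "u \<in> range A" "v \<in> range A" for u v
      using that by (auto simp flip: A.add)
    have scale: "a *\<^sub>C u \<in> range A" if "u \<in> range A" for a u
      using that by (auto simp flip: bounded_clinear_scaleC[OF A])
    obtain m q where m: "\<And>n::nat. m n \<in> range A" and q: "m \<longlonglongrightarrow> q"
      and orth: "\<And>z. z \<in> range A \<Longrightarrow> cinner (y - q) z = 0"
      by (rule clinear_subspace_projection[of "range A" y, OF zero add scale]) blast+
    have "\<forall>n. \<exists>x. m n = A x"
      using m by auto
    then obtain x where "\<And>n. m n = A (x n)"
      by metis
    then have x: "m = (\<lambda>n. A (x n))"
      by blast
    have "Cauchy (\<lambda>n. A (x n))"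
      using q x LIMSEQ_imp_Cauchy by blast
    then have "Cauchy (\<lambda>n. B (x n))"
      by (simp add: Cauchy_def dist_norm norm_eq flip: A.diff B.diff)
    then obtain v where v: "(\<lambda>n. B (x n)) \<longlonglongrightarrow> v"
      using Cauchy_convergent convergent_def by blast
    have "norm v = norm q"
      using LIMSEQ_unique[OF tendsto_norm[OF v]] tendsto_norm[OF q] by (simp add: x norm_eq)
    \<comment> \<open>Orthogonality to every \<open>m n\<close> passes to their limit
      \<open>q\<close>; Pythagoras then shows that projecting does not increase the norm.\<close>
    moreover have "cinner (y - q) q = 0"
      using LIMSEQ_unique[OF cinner.tendsto[OF tendsto_const[of "y - q"] q]] orth[OF m] by simp
    then have "(norm y)\<^sup>2 = (norm (y - q))\<^sup>2 + (norm q)\<^sup>2"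
      using norm_add_squared[of "y - q" q] by simp
    then have "norm q \<le> norm y"
      by (simp add: power2_le_imp_le)
    ultimately have "norm v \<le> norm y"
      by simp
    moreover have "cinner v w = 0" if "w \<in> N" for w
      using LIMSEQ_unique[OF cinner.tendsto[OF v tendsto_const[of w]]] that by (simp add: N_def)
    moreover have "cinner (B z) v = cinner (A z) y" for z
    proof -
      have "cinner (B z) v = cinner (A z) q"
        using LIMSEQ_unique[OF cinner.tendsto[OF tendsto_const[of "B z"] v]]
          cinner.tendsto[OF tendsto_const[of "A z"] q] by (simp add: x gram)
      moreover have "cinner (A z) (y - q) = 0"
        using orth[of "A z"] by (metis cinner_commute complex_cnj_zero rangeI)
      ultimately show ?thesis
        by (simp add: cinner.diff_right)
    qed
    ultimately show ?thesis
      by blast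
  qed
  then obtain V where V_norm: "\<And>y. norm (V y) \<le> norm y"
    and V_N: "\<And>y w. w \<in> N \<Longrightarrow> cinner (V y) w = 0"
    and V: "\<And>x y. cinner (B x) (V y) = cinner (A x) y"
    by metis
  have "V (x + y) = V x + V y" for x y
    by (rule char_unique) (simp_all add: V V_N cinner_add_left cinner_add_right)
  moreover have "V (a *\<^sub>C x) = a *\<^sub>C V x" for a x
    by (rule char_unique) (simp_all add: V V_N cinner_scaleC_left cinner_scaleC_right)
  ultimately have "bounded_clinear V"
    using V_norm by (auto simp: bounded_clinear_def clinear_def intro: exI[of _ 1])
  \<comment> \<open>\<open>B x\<close> itself has the two properties that determine the image of
    \<open>A x\<close>.\<close>
  moreover have "V (A x) = B x" for x
    by (rule char_unique) (simp_all add: V V_N gram N_def)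
  ultimately show thesis
    using that V_norm V by blast
qed

text \<open>\<open>T\<close> and \<open>abs_op T\<close> have the same Gram form, since
  \<open>abs_op T\<close> is self-adjoint with square \<open>cadjoint T \<circ> T\<close>. The
  resulting contraction is \<open>V\<close>, and \<open>U\<close> is its adjoint.\<close>

lemma polar_decomposition:
  fixes T :: "'a::chilbert_space \<Rightarrow> 'b::chilbert_space"
  assumes T: "bounded_clinear T"
  obtains U V where "bounded_clinear U" "\<And>x. norm (U x) \<le> norm x"
    "bounded_clinear V" "\<And>y. norm (V y) \<le> norm y"
    "T = U \<circ> abs_op T" "abs_op T = V \<circ> T" "cadjoint T = abs_op T \<circ> V" "abs_op T = cadjoint T \<circ> U"
proof -
  note pos = abs_op_properties(1)[OF T]
  have P: "bounded_clinear (abs_op T)"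
    using pos by (simp add: positive_op_def)
  have "cinner (T x) (T z) = cinner (abs_op T x) (abs_op T z)" for x z
    using fun_cong[OF abs_op_properties(2)[OF T], of z]
    by (simp add: positive_op_selfadjoint[OF pos] cinner_cadjoint[OF T])
  then obtain V where V: "bounded_clinear V" and V_norm: "\<And>y. norm (V y) \<le> norm y"
    and VT: "\<And>x. V (T x) = abs_op T x"
    and V_adj: "\<And>x y. cinner (abs_op T x) (V y) = cinner (T x) y"
    by (rule equal_gram_contraction[OF T P]) blast
  define U where "U = cadjoint V"
  have U: "bounded_clinear U"
    unfolding U_def by (rule bounded_clinear_cadjoint[OF V])
  have UV: "cinner (U x) y = cinner x (V y)" for x y
    unfolding U_def by (rule cinner_cadjoint_left[OF V])
  have U_norm: "norm (U x) \<le> norm x" for x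
    using norm_adjoint_le[OF cinner_cadjoint[OF V], of 1 x] V_norm by (simp add: U_def)
  have UP: "U (abs_op T x) = T x" for x
    by (metis UV V_adj cinner_commute cinner_eqI)
  have T_adj: "cadjoint T y = abs_op T (V y)" for y
    by (rule cinner_eqI) (simp add: V_adj flip: cinner_cadjoint[OF T] positive_op_selfadjoint[OF pos])
  have P_adj: "abs_op T x = cadjoint T (U x)" for x
  proof (rule cinner_eqI)
    fix z
    have "cinner z (cadjoint T (U x)) = cinner (V (T z)) x"
      by (metis UV cinner_cadjoint[OF T] cinner_commute)
    then show "cinner z (abs_op T x) = cinner z (cadjoint T (U x))"
      by (simp add: VT positive_op_selfadjoint[OF pos])
  qed
  show thesis
  proof (rule that[of U V])
    show "T = U \<circ> abs_op T" "abs_op T = V \<circ> T"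
      by (simp_all add: fun_eq_iff UP VT)
    show "cadjoint T = abs_op T \<circ> V" "abs_op T = cadjoint T \<circ> U"
      unfolding fun_eq_iff comp_apply using T_adj P_adj by blast+
  qed (fact U U_norm V V_norm)+
qed

section \<open>Coverings and composition with contractions\<close>

lemma entropy_number_cong:
  fixes S :: "'a::real_normed_vector \<Rightarrow> 'b::real_normed_vector"
    and R :: "'c::real_normed_vector \<Rightarrow> 'd::real_normed_vector"
  assumes "\<And>\<epsilon> k. (\<exists>y. S ` cball 0 1 \<subseteq> (\<Union>i\<in>{1..k::nat}. cball (y i) \<epsilon>))
    \<longleftrightarrow> (\<exists>z. R ` cball 0 1 \<subseteq> (\<Union>i\<in>{1..k::nat}. cball (z i) \<epsilon>))"
  shows "entropy_number n S = entropy_number n R"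
  unfolding entropy_number_def by (simp only: assms)

text \<open>The images of the old centers under \<open>C\<close> serve as new centers: a linear
  contraction sends each ball into the ball of the same radius about the image of its
  center.\<close>

lemma covering_compose_contraction_left:
  fixes S :: "'a::real_normed_vector \<Rightarrow> 'b::complex_inner" and C :: "'b \<Rightarrow> 'c::complex_inner"
  assumes "bounded_clinear C" and contr: "\<And>x. norm (C x) \<le> norm x"
    and cover: "S ` cball 0 1 \<subseteq> (\<Union>i\<in>I. cball (y i) \<epsilon>)"
  shows "\<exists>z. (C \<circ> S) ` cball 0 1 \<subseteq> (\<Union>i\<in>I. cball (z i) \<epsilon>)"
proof -
  interpret C: bounded_linear C
    by (rule bounded_clinear_imp_bounded_linear) fact
  have "C u \<in> cball (C v) \<epsilon>" if "u \<in> cball v \<epsilon>" for u v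
    using that contr[of "v - u"] by (simp add: dist_norm C.diff)
  moreover have "\<exists>i\<in>I. S x \<in> cball (y i) \<epsilon>" if "x \<in> cball 0 1" for x
    using cover that by blast
  ultimately have "(C \<circ> S) x \<in> (\<Union>i\<in>I. cball (C (y i)) \<epsilon>)" if "x \<in> cball 0 1" for x
    using that unfolding comp_apply by blast
  then show ?thesis
    by (intro exI[of _ "\<lambda>i. C (y i)"] image_subsetI)
qed

text \<open>The same centers work, as \<open>C\<close> maps the unit ball into the unit
  ball.\<close>

lemma covering_compose_contraction_right:
  fixes S :: "'b::real_normed_vector \<Rightarrow> 'c::real_normed_vector" and C :: "'a::real_normed_vector \<Rightarrow> 'b"
  assumes "\<And>x. norm (C x) \<le> norm x"
    and "S ` cball 0 1 \<subseteq> (\<Union>i\<in>I. cball (y i) \<epsilon>)"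
  shows "\<exists>z. (S \<circ> C) ` cball 0 1 \<subseteq> (\<Union>i\<in>I. cball (z i) \<epsilon>)"
proof -
  have "C x \<in> cball 0 1" if "x \<in> cball 0 1" for x
    using that assms(1)[of x] by simp
  then have "(S \<circ> C) ` cball 0 1 \<subseteq> S ` cball 0 1"
    by (auto simp del: mem_cball)
  then show ?thesis
    using assms(2) by blast
qed

theorem theorem1p1:
  fixes T :: "'a::chilbert_space \<Rightarrow> 'b::chilbert_space"
    and n :: nat
  assumes "separable_space (euclidean :: 'a topology)"
    and "separable_space (euclidean :: 'b topology)"
    and "bounded_clinear T"
    and "n \<ge> 1"
  shows "entropy_number n T = entropy_number n (cadjoint T) \<and>
    entropy_number n (cadjoint T) = entropy_number n (abs_op T)"
proof -
  obtain U V where U: "bounded_clinear U" "\<And>x. norm (U x) \<le> norm x"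
    and V: "bounded_clinear V" "\<And>y. norm (V y) \<le> norm y"
    and eqs: "T = U \<circ> abs_op T" "abs_op T = V \<circ> T"
      "cadjoint T = abs_op T \<circ> V" "abs_op T = cadjoint T \<circ> U"
    by (rule polar_decomposition[OF assms(3)]) blast
  \<comment> \<open>\<open>T\<close> and \<open>abs_op T\<close> share their domain, so a
    contraction on the left passes between them; \<open>cadjoint T\<close> and
    \<open>abs_op T\<close> share their codomain, so there it acts on the right. In both cases the
    admissible radii agree for each number \<open>k\<close> of balls, so the infima are taken over
    equal sets.\<close>
  have "entropy_number n T = entropy_number n (abs_op T)"
  proof (rule entropy_number_cong, intro iffI; elim exE)
    show "\<exists>z. abs_op T ` cball 0 1 \<subseteq> (\<Union>i\<in>{1..k}. cball (z i) \<epsilon>)"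
      if "T ` cball 0 1 \<subseteq> (\<Union>i\<in>{1..k}. cball (y i) \<epsilon>)" for \<epsilon> and k :: nat and y
      using covering_compose_contraction_left[OF V that] by (simp only: eqs(2)[symmetric])
    show "\<exists>y. T ` cball 0 1 \<subseteq> (\<Union>i\<in>{1..k}. cball (y i) \<epsilon>)"
      if "abs_op T ` cball 0 1 \<subseteq> (\<Union>i\<in>{1..k}. cball (z i) \<epsilon>)" for \<epsilon> and k :: nat and z
      using covering_compose_contraction_left[OF U that] by (simp only: eqs(1)[symmetric])
  qed
  moreover have "entropy_number n (cadjoint T) = entropy_number n (abs_op T)"
  proof (rule entropy_number_cong, intro iffI; elim exE)
    show "\<exists>z. abs_op T ` cball 0 1 \<subseteq> (\<Union>i\<in>{1..k}. cball (z i) \<epsilon>)"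
      if "cadjoint T ` cball 0 1 \<subseteq> (\<Union>i\<in>{1..k}. cball (y i) \<epsilon>)" for \<epsilon> and k :: nat and y
      using covering_compose_contraction_right[OF U(2) that] by (simp only: eqs(4)[symmetric])
    show "\<exists>y. cadjoint T ` cball 0 1 \<subseteq> (\<Union>i\<in>{1..k}. cball (y i) \<epsilon>)"
      if "abs_op T ` cball 0 1 \<subseteq> (\<Union>i\<in>{1..k}. cball (z i) \<epsilon>)" for \<epsilon> and k :: nat and z
      using covering_compose_contraction_right[OF V(2) that] by (simp only: eqs(3)[symmetric])
  qed
  ultimately show ?thesis
    by simp
qed

end
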